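(* Let $X=\prod_{i=1}^n\{0,\dots,m_i\}$ and $f\colon X\to X$, and let $f^b=\beta\circ f\circ\beta^{-1}\colon\mathcal{A}\to\mathcal{A}$. If the asynchronous dynamics $AD_f$ admits two distinct attractors, then there exists $x\in\mathcal{A}$ such that the local interaction graph $G_{f^b}(x)$ contains a positive cycle.
   Context: $m_i\ge1$, $m=\sum_i m_i$; coordinates of $\{0,1\}^m$ are indexed by $I=\{(i,j)\mid 1\le i\le n,\,1\le j\le m_i\}$. $\beta\colon X\to\{0,1\}^m$ is given by $\beta_{i,j}(x)=1$ iff $x_i\ge j$; $\mathcal{A}=\beta(X)$. $e^k$ is the $k$-th unit vector, $\mathrm{sign}(0)=0$. The asynchronous dynamics $AD_f$ is the directed graph on $X$ with an edge $(x,x+se^i)$ whenever $s=\mathrm{sign}(f_i(x)-x_i)\ne0$. A nonempty $T\subseteq X$ is a trap set if every edge leaving a state of $T$ ends in $T$; attractors are the inclusion-minimal trap sets. For a map $g\colon Y\to Y$, $Y$ a set of integer vectors with coordinates indexed by a finite set $J$, the local interaction graph $G_g(z)$ at $z\in Y$ has vertex set $J$ and an edge from $j$ to $i$ with sign $s_1\,\mathrm{sign}(g_i(z+s_1e^j)-g_i(z))$ whenever $s_1\in\{-1,1\}$, $z+s_1e^j\in Y$ and this sign is nonzero. Cycles are elementary directed cycles (loops allowed), with sign the product of edge signs. *)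

theory Defs
  imports Complex_Main "HOL-Library.FuncSet" "Graph_Theory.Arc_Walk"
begin

text \<open>
  An integer vector with coordinates indexed by a set \<open>J\<close> is a function to \<^typ>\<open>int\<close> that
  vanishes outside \<open>J\<close>, so that equality of vectors is equality of functions.
\<close>

definition state_space :: "nat \<Rightarrow> (nat \<Rightarrow> nat) \<Rightarrow> (nat \<Rightarrow> int) set" where
  "state_space n m =
    {x. (\<forall>i\<in>{1..n}. x i \<in> {0..int (m i)}) \<and> (\<forall>i. i \<notin> {1..n} \<longrightarrow> x i = 0)}"

definition unit_vec :: "'j \<Rightarrow> 'j \<Rightarrow> int" where
  "unit_vec k = (\<lambda>l. if l = k then 1 else 0)"

text \<open>\<open>shift z s k\<close> is \<open>z + s e^k\<close>, with \<open>e^k\<close> the unit vector.\<close>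

definition shift :: "('j \<Rightarrow> int) \<Rightarrow> int \<Rightarrow> 'j \<Rightarrow> ('j \<Rightarrow> int)" where
  "shift z s k = (\<lambda>l. z l + s * unit_vec k l)"

definition bool_index :: "nat \<Rightarrow> (nat \<Rightarrow> nat) \<Rightarrow> (nat \<times> nat) set" where
  "bool_index n m = {(i, j). 1 \<le> i \<and> i \<le> n \<and> 1 \<le> j \<and> j \<le> m i}"

definition bool_encoding :: "nat \<Rightarrow> (nat \<Rightarrow> nat) \<Rightarrow> (nat \<Rightarrow> int) \<Rightarrow> (nat \<times> nat \<Rightarrow> int)" where
  "bool_encoding n m x =
    (\<lambda>(i, j). if (i, j) \<in> bool_index n m \<and> x i \<ge> int j then 1 else 0)"

definition admissible :: "nat \<Rightarrow> (nat \<Rightarrow> nat) \<Rightarrow> (nat \<times> nat \<Rightarrow> int) set" where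
  "admissible n m = bool_encoding n m ` state_space n m"

definition bool_map ::
  "nat \<Rightarrow> (nat \<Rightarrow> nat) \<Rightarrow> ((nat \<Rightarrow> int) \<Rightarrow> (nat \<Rightarrow> int)) \<Rightarrow> (nat \<times> nat \<Rightarrow> int) \<Rightarrow> (nat \<times> nat \<Rightarrow> int)"
where
  "bool_map n m f =
    bool_encoding n m \<circ> f \<circ> inv_into (state_space n m) (bool_encoding n m)"

definition async_dynamics ::
  "nat \<Rightarrow> (nat \<Rightarrow> nat) \<Rightarrow> ((nat \<Rightarrow> int) \<Rightarrow> (nat \<Rightarrow> int)) \<Rightarrow> (nat \<Rightarrow> int, (nat \<Rightarrow> int) \<times> (nat \<Rightarrow> int)) pre_digraph"
where
  "async_dynamics n m f =
    \<lparr>verts = state_space n m,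
     arcs = {(x, shift x s i) | x s i.
       x \<in> state_space n m \<and> i \<in> {1..n} \<and> s = sgn (f x i - x i) \<and> s \<noteq> 0},
     tail = fst, head = snd\<rparr>"

definition trap_set :: "('v, 'e) pre_digraph \<Rightarrow> 'v set \<Rightarrow> bool" where
  "trap_set G T \<longleftrightarrow> T \<noteq> {} \<and> T \<subseteq> verts G \<and> (\<forall>e\<in>arcs G. tail G e \<in> T \<longrightarrow> head G e \<in> T)"

definition attractor :: "('v, 'e) pre_digraph \<Rightarrow> 'v set \<Rightarrow> bool" where
  "attractor G T \<longleftrightarrow> trap_set G T \<and> (\<forall>T'. trap_set G T' \<and> T' \<subseteq> T \<longrightarrow> T' = T)"

text \<open>
  An arc \<open>(j, s, i)\<close> is an edge from \<open>j\<close> to \<open>i\<close> of sign \<open>s\<close>. Two vertices can be joined by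
  a positive and a negative edge at the same time.
\<close>

definition local_interaction_graph ::
  "'j set \<Rightarrow> ('j \<Rightarrow> int) set \<Rightarrow> (('j \<Rightarrow> int) \<Rightarrow> ('j \<Rightarrow> int)) \<Rightarrow> ('j \<Rightarrow> int) \<Rightarrow> ('j, 'j \<times> int \<times> 'j) pre_digraph"
where
  "local_interaction_graph J Y g z =
    \<lparr>verts = J,
     arcs = {(j, s, i) | j s i. j \<in> J \<and> i \<in> J \<and>
       (\<exists>s1\<in>{-1, 1}. shift z s1 j \<in> Y \<and> s = s1 * sgn (g (shift z s1 j) i - g z i) \<and> s \<noteq> 0)},
     tail = fst, head = (\<lambda>e. snd (snd e))\<rparr>"

definition positive_cycle :: "('j, 'j \<times> int \<times> 'j) pre_digraph \<Rightarrow> ('j \<times> int \<times> 'j) list \<Rightarrow> bool" where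
  "positive_cycle G p \<longleftrightarrow>
    pre_digraph.cycle G p \<and> prod_list (map (\<lambda>(j, s, i). s) p) = 1"

lemma inj_on_bool_encoding: "inj_on (bool_encoding n m) (state_space n m)"
proof (rule inj_onI, rule ext)
  fix x y i
  assume x: "x \<in> state_space n m" and y: "y \<in> state_space n m"
    and eq: "bool_encoding n m x = bool_encoding n m y"
  show "x i = y i"
  proof (cases "i \<in> {1..n}")
    case True
    have b: "0 \<le> x i" "x i \<le> int (m i)" "0 \<le> y i" "y i \<le> int (m i)"
      using x y True by (auto simp: state_space_def)
    have iff: "int j \<le> x i \<longleftrightarrow> int j \<le> y i" if "1 \<le> j" "j \<le> m i" for j
      using fun_cong[OF eq, of "(i, j)"] that True
      by (auto simp: bool_encoding_def bool_index_def split: if_splits)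
    show ?thesis
      using iff[of "nat (x i)"] iff[of "nat (y i)"] b by linarith
  next
    case False
    then show ?thesis using x y by (auto simp: state_space_def)
  qed
qed

lemma bool_map_bool_encoding:
  "x \<in> state_space n m \<Longrightarrow> bool_map n m f (bool_encoding n m x) = bool_encoding n m (f x)"
  by (simp add: bool_map_def inv_into_f_f[OF inj_on_bool_encoding])

end

theory Submission
  imports Defs "Graph_Theory.Digraph_Component"
begin

text \<open>
  Distinct attractors are disjoint, so one can pick \<open>x\<close> in the first and \<open>y\<close> in the second at
  minimal \<open>L\<^sup>1\<close>-distance; then no edge at \<open>x\<close> points towards \<open>y\<close>, nor any edge at \<open>y\<close> towards \<open>x\<close>.
  Move \<open>x\<close> one step towards \<open>y\<close> in some coordinate \<open>i\<close> in which they differ. If each of these moves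
  makes some coordinate \<open>j\<close> of \<open>f\<close> point towards \<open>y\<close>, every such \<open>i\<close> has an edge to such a \<open>j\<close> in the
  local interaction graph at \<open>x\<close>, whose sign is the product of the directions of \<open>i\<close> and \<open>j\<close>;
  following these edges closes a cycle, and its sign is a product of squares. Otherwise some move
  gives a state closer to \<open>y\<close> that still has no edge towards \<open>y\<close>, and one argues by induction on
  the distance.
\<close>

section \<open>Positive cycles from coherent signs\<close>

text \<open>If the adjacency relation on the finite set \<open>S\<close> were acyclic, its converse
  would be well-founded, and a minimal element would have no successor in \<open>S\<close>. So some
  closed walk exists, and it contains an elementary cycle.\<close>

lemma (in wf_digraph) cycle_if_out_arcs:
  assumes "finite S" and "S \<noteq> {}"
    and out: "\<And>u. u \<in> S \<Longrightarrow> \<exists>e\<in>arcs G. tail G e = u \<and> head G e \<in> S"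
  shows "\<exists>p. cycle p"
proof -
  define r where "r = {(u, v) \<in> S \<times> S. u \<rightarrow> v}"
  have "finite r"
    using \<open>finite S\<close> by (auto simp: r_def intro: finite_subset[of _ "S \<times> S"])
  have "\<not> acyclic r"
  proof
    assume "acyclic r"
    then have "wf (r\<inverse>)"
      using \<open>finite r\<close> by (rule finite_acyclic_wf_converse[rotated])
    then obtain u where "u \<in> S" "\<And>v. (v, u) \<in> r\<inverse> \<Longrightarrow> v \<notin> S"
      using \<open>S \<noteq> {}\<close> by (metis wfE_min ex_in_conv)
    moreover from out[OF \<open>u \<in> S\<close>] obtain v where "v \<in> S" "u \<rightarrow> v"
      by (auto intro: in_arcs_imp_in_arcs_ends)
    moreover from this have "(v, u) \<in> r\<inverse>"
      using \<open>u \<in> S\<close> by (simp add: r_def)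
    ultimately show False by blast
  qed
  then obtain u where "(u, u) \<in> r\<^sup>+" by (auto simp: acyclic_def)
  then have "u \<rightarrow>\<^sup>+ u"
    by (rule trancl_mono) (auto simp: r_def)
  then have "\<exists>p. closed_w p"
    unfolding reachable1_awalk closed_w_def by blast
  then show ?thesis by (blast intro: closed_w_imp_cycle)
qed

text \<open>Signs of the form \<open>\<sigma> u * \<sigma> v\<close> telescope: along a walk each
  inner vertex contributes a square, and on a closed walk so do the two ends.\<close>

lemma positive_cycle_if_coherent:
  fixes G :: "('j, 'j \<times> int \<times> 'j) pre_digraph" and \<sigma> :: "'j \<Rightarrow> int"
  assumes wf: "wf_digraph G" and tail: "tail G = fst" and head: "head G = (\<lambda>e. snd (snd e))"
    and S: "finite S" "S \<noteq> {}" "S \<subseteq> verts G"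
    and \<sigma>: "\<And>u. u \<in> S \<Longrightarrow> \<sigma> u * \<sigma> u = 1"
    and out: "\<And>u. u \<in> S \<Longrightarrow> \<exists>v\<in>S. (u, \<sigma> u * \<sigma> v, v) \<in> arcs G"
  shows "\<exists>p. positive_cycle G p"
proof -
  \<comment> \<open>\<open>G\<close> may also have a parallel arc of the opposite sign; searching in
    \<open>H\<close> forces the cycle to use coherent arcs only.\<close>
  define H where "H = \<lparr>verts = S, arcs = {(u, \<sigma> u * \<sigma> v, v) | u v. u \<in> S \<and> v \<in> S} \<inter> arcs G,
    tail = tail G, head = head G\<rparr>"
  have H_ends: "tail H = fst" "head H = (\<lambda>e. snd (snd e))"
    by (simp_all add: H_def tail head)
  interpret H: wf_digraph H
    by unfold_locales (auto simp: H_def tail head)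
  have sub: "subgraph H G"
    using wf S by (auto simp: subgraph_def H_def compatible_def H.wf_digraph_axioms[unfolded H_def])
  have "\<exists>p. H.cycle p"
  proof (rule H.cycle_if_out_arcs[OF S(1,2)])
    fix u assume "u \<in> S"
    with out obtain v where "v \<in> S" "(u, \<sigma> u * \<sigma> v, v) \<in> arcs G" by blast
    with \<open>u \<in> S\<close> show "\<exists>e\<in>arcs H. tail H e = u \<and> head H e \<in> S"
      by (intro bexI[of _ "(u, \<sigma> u * \<sigma> v, v)"]) (auto simp: H_def tail head)
  qed
  then obtain p where p: "H.cycle p" by blast
  have sign: "prod_list (map (\<lambda>(j, s, i). s) q) = \<sigma> u * \<sigma> v"
    if "H.cas u q v" "set q \<subseteq> arcs H" "u \<in> S" for u q v
    using that
  proof (induction q arbitrary: u)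
    case Nil
    then show ?case using \<sigma> by simp
  next
    case (Cons e q)
    have "fst e = u" "e \<in> arcs H" "set q \<subseteq> arcs H" "H.cas (snd (snd e)) q v"
      using Cons.prems by (simp_all add: H_ends)
    then obtain w where w: "e = (u, \<sigma> u * \<sigma> w, w)" "w \<in> S"
      by (auto simp: H_def)
    have "prod_list (map (\<lambda>(j, s, i). s) q) = \<sigma> w * \<sigma> v"
      using Cons.IH[of w] w \<open>H.cas _ q v\<close> \<open>set q \<subseteq> _\<close> by simp
    then have "prod_list (map (\<lambda>(j, s, i). s) (e # q)) = \<sigma> u * (\<sigma> w * \<sigma> w) * \<sigma> v"
      by (simp add: w)
    then show ?case
      using \<sigma>[OF w(2)] by simp
  qed
  from p obtain u where "H.awalk u p u" by (auto simp: H.cycle_def)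
  then have "H.cas u p u" "set p \<subseteq> arcs H" "u \<in> S"
    by (simp_all add: H.awalk_def) (simp add: H_def)
  then have "prod_list (map (\<lambda>(j, s, i). s) p) = 1"
    using sign \<sigma> by metis
  moreover have "pre_digraph.cycle G p"
    using wf_digraph.subgraph_cycle[OF wf sub p] .
  ultimately show ?thesis by (auto simp: positive_cycle_def)
qed

section \<open>Unit steps and the threshold encoding\<close>

lemma wf_digraph_local_interaction_graph: "wf_digraph (local_interaction_graph J Y g z)"
  by unfold_locales (auto simp: local_interaction_graph_def)

lemma local_interaction_graph_sel:
  "verts (local_interaction_graph J Y g z) = J"
  "tail (local_interaction_graph J Y g z) = fst"
  "head (local_interaction_graph J Y g z) = (\<lambda>e. snd (snd e))"
  by (simp_all add: local_interaction_graph_def)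

lemma arc_local_interaction_graph_iff:
  "(j, s, i) \<in> arcs (local_interaction_graph J Y g z) \<longleftrightarrow> j \<in> J \<and> i \<in> J \<and>
    (\<exists>s1\<in>{-1, 1}. shift z s1 j \<in> Y \<and> s = s1 * sgn (g (shift z s1 j) i - g z i) \<and> s \<noteq> 0)"
  by (simp add: local_interaction_graph_def)

lemma shift_apply: "shift x s i j = (if j = i then x j + s else x j)"
  by (simp add: shift_def unit_vec_def)

lemma shift_towards_in_state_space:
  assumes "x \<in> state_space n m" "y \<in> state_space n m" "i \<in> {1..n}"
  shows "shift x (sgn (y i - x i)) i \<in> state_space n m"
  using assms by (auto simp: state_space_def shift_apply sgn_if Ball_def)

text \<open>The index of the bit that flips when coordinate \<open>i\<close> moves one step from \<open>x\<close> towards \<open>y\<close>.\<close>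

definition flip_index :: "(nat \<Rightarrow> int) \<Rightarrow> (nat \<Rightarrow> int) \<Rightarrow> nat \<Rightarrow> nat \<times> nat" where
  "flip_index x y i = (i, nat (if x i < y i then x i + 1 else x i))"

lemma flip_index_in_bool_index:
  assumes "x \<in> state_space n m" "y \<in> state_space n m" "i \<in> {1..n}" "x i \<noteq> y i"
  shows "flip_index x y i \<in> bool_index n m"
proof -
  have "0 \<le> x i" "x i \<le> int (m i)" "0 \<le> y i" "y i \<le> int (m i)"
    using assms by (auto simp: state_space_def)
  then show ?thesis using assms(3,4)
    by (auto simp: flip_index_def bool_index_def)
qed

lemma bool_encoding_shift_towards:
  assumes "x \<in> state_space n m" "y \<in> state_space n m" "i \<in> {1..n}" "x i \<noteq> y i"
  shows "bool_encoding n m (shift x (sgn (y i - x i)) i) =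
    shift (bool_encoding n m x) (sgn (y i - x i)) (flip_index x y i)"
proof (intro ext, clarify)
  fix k j
  have "0 \<le> x i" "x i \<le> int (m i)" "0 \<le> y i" "y i \<le> int (m i)"
    using assms by (auto simp: state_space_def)
  note bounds = this
  have i: "1 \<le> i" "i \<le> n" using assms(3) by auto
  consider "k \<noteq> i" | "k = i" "x i < y i" | "k = i" "y i < x i"
    using assms(4) by linarith
  then show "bool_encoding n m (shift x (sgn (y i - x i)) i) (k, j) =
      shift (bool_encoding n m x) (sgn (y i - x i)) (flip_index x y i) (k, j)"
    using bounds i
    by cases (auto simp: bool_encoding_def shift_apply flip_index_def bool_index_def)
qed

text \<open>The threshold \<open>flip_index x y i\<close> lies between \<open>x i\<close> and the
  next value towards \<open>y i\<close>, so it separates \<open>a i\<close> from \<open>b i\<close>.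
  This is applied to images under \<open>f\<close>, to read off the sign of an edge.\<close>

lemma bool_encoding_flip_index_diff:
  assumes "x \<in> state_space n m" "y \<in> state_space n m" "i \<in> {1..n}"
    and "sgn (y i - x i) * (a i - x i) \<le> 0" "sgn (y i - x i) * (b i - x i) > 0"
  shows "bool_encoding n m b (flip_index x y i) - bool_encoding n m a (flip_index x y i) =
    sgn (y i - x i)"
proof -
  have "x i \<noteq> y i" using assms(5) by auto
  note idx = flip_index_in_bool_index[OF assms(1-3) this]
  have "0 \<le> x i" using assms by (auto simp: state_space_def)
  then show ?thesis using idx assms(4,5) \<open>x i \<noteq> y i\<close>
    by (auto simp: bool_encoding_def flip_index_def sgn_if split: if_splits)
qed

section \<open>Pairs of states without edges towards each other\<close>

text \<open>The condition at \<open>x\<close> is the invariant carried along as \<open>x\<close>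
  moves to the fixed \<open>y\<close>; the condition at \<open>y\<close> prevents the walk from
  reaching \<open>y\<close>.\<close>

lemma positive_cycle_if_blocked:
  assumes x: "x \<in> state_space n m" and y: "y \<in> state_space n m" and "x \<noteq> y"
    and fx: "\<And>i. i \<in> {1..n} \<Longrightarrow> sgn (y i - x i) * (f x i - x i) \<le> 0"
    and fy: "\<And>i. i \<in> {1..n} \<Longrightarrow> sgn (y i - x i) * (f y i - y i) \<ge> 0"
  shows "\<exists>z\<in>admissible n m. \<exists>p. positive_cycle
    (local_interaction_graph (bool_index n m) (admissible n m) (bool_map n m f) z) p"
  using x \<open>x \<noteq> y\<close> fx fy
proof (induction "\<Sum>i=1..n. nat \<bar>y i - x i\<bar>" arbitrary: x rule: less_induct)
  case less
  note x = less.prems(1) and fx = less.prems(3) and fy = less.prems(4)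
  define D where "D = {i \<in> {1..n}. x i \<noteq> y i}"
  define s where "s i = sgn (y i - x i)" for i
  have "D \<noteq> {}"
  proof
    assume "D = {}"
    then have "x i = y i" for i
      using x y by (cases "i \<in> {1..n}") (auto simp: D_def state_space_def)
    with \<open>x \<noteq> y\<close> show False by blast
  qed
  show ?case
  \<comment> \<open>The comparison is with the old value \<open>x j\<close>, because the bit
    \<open>flip_index x y j\<close> is a threshold next to \<open>x j\<close>. The choice
    \<open>j = i\<close> is allowed and gives a positive loop.\<close>
  proof (cases "\<forall>i\<in>D. \<exists>j\<in>D. s j * (f (shift x (s i) i) j - x j) > 0")
    case True
    let ?G = "local_interaction_graph (bool_index n m) (admissible n m) (bool_map n m f)
      (bool_encoding n m x)"
    let ?S = "flip_index x y ` D"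
    have "\<exists>p. positive_cycle ?G p"
    \<comment> \<open>Each coordinate in \<open>D\<close> contributes one bit, and
      \<open>fst\<close> recovers the coordinate from it.\<close>
    proof (rule positive_cycle_if_coherent[where S = ?S and \<sigma> = "s \<circ> fst"])
      fix u assume "u \<in> ?S"
      then obtain i where i: "i \<in> D" and u: "u = flip_index x y i" by blast
      from True i obtain j where j: "j \<in> D" "s j * (f (shift x (s i) i) j - x j) > 0" by blast
      let ?v = "flip_index x y j" and ?x' = "shift x (s i) i"
      have x': "?x' \<in> state_space n m"
        using i shift_towards_in_state_space[OF x y] by (auto simp: s_def D_def)
      have enc: "shift (bool_encoding n m x) (s i) u = bool_encoding n m ?x'"
        using i bool_encoding_shift_towards[OF x y] by (auto simp: s_def D_def u)
      have "bool_encoding n m (f ?x') ?v - bool_encoding n m (f x) ?v = s j"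
        unfolding s_def
        by (rule bool_encoding_flip_index_diff[OF x y])
          (use j fx in \<open>auto simp: D_def s_def\<close>)
      then have diff: "bool_map n m f (shift (bool_encoding n m x) (s i) u) ?v -
          bool_map n m f (bool_encoding n m x) ?v = s j"
        by (simp add: enc bool_map_bool_encoding x x')
      have "(u, s i * s j, ?v) \<in> arcs ?G"
      proof -
        have idx: "u \<in> bool_index n m" "?v \<in> bool_index n m"
          using i j flip_index_in_bool_index[OF x y] by (auto simp: u D_def)
        have "s i \<in> {-1, 1}" "sgn (s j) = s j" "s i * s j \<noteq> 0"
          using i j by (auto simp: s_def D_def sgn_if)
        moreover have "shift (bool_encoding n m x) (s i) u \<in> admissible n m"
          using x' by (simp add: enc admissible_def)
        ultimately have "\<exists>s1\<in>{-1, 1}. shift (bool_encoding n m x) s1 u \<in> admissible n m \<and>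
            s i * s j = s1 * sgn (bool_map n m f (shift (bool_encoding n m x) s1 u) ?v -
              bool_map n m f (bool_encoding n m x) ?v) \<and> s i * s j \<noteq> 0"
          by (intro bexI[of _ "s i"]) (simp_all only: diff simp_thms)
        with idx show ?thesis
          unfolding arc_local_interaction_graph_iff by (intro conjI)
      qed
      then show "\<exists>v\<in>?S. (u, (s \<circ> fst) u * (s \<circ> fst) v, v) \<in> arcs ?G"
        using j by (intro bexI[of _ ?v]) (auto simp: u flip_index_def)
    next
      show "?S \<subseteq> verts ?G"
        using flip_index_in_bool_index[OF x y] by (auto simp: local_interaction_graph_sel D_def)
      show "finite ?S" by (simp add: D_def)
      show "(s \<circ> fst) u * (s \<circ> fst) u = 1" if "u \<in> ?S" for u
        using that by (auto simp: D_def s_def flip_index_def sgn_if)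
    qed (simp_all add: \<open>D \<noteq> {}\<close> wf_digraph_local_interaction_graph local_interaction_graph_sel)
    then show ?thesis using x by (auto simp: admissible_def)
  next
    case False
    then obtain i where i: "i \<in> D" "\<And>j. j \<in> D \<Longrightarrow> s j * (f (shift x (s i) i) j - x j) \<le> 0"
      by (meson not_less)
    let ?x' = "shift x (s i) i"
    have x': "?x' \<in> state_space n m"
      using i shift_towards_in_state_space[OF x y] by (auto simp: s_def D_def)
    \<comment> \<open>A unit step towards \<open>y\<close> cannot overshoot: each direction is kept
      or becomes 0.\<close>
    have s': "sgn (y j - ?x' j) = s j \<and> x j \<noteq> y j \<or> sgn (y j - ?x' j) = 0" for j
      by (auto simp: s_def shift_apply sgn_if)
    show ?thesis
    proof (rule less.hyps[OF _ x'])
      show "(\<Sum>k=1..n. nat \<bar>y k - ?x' k\<bar>) < (\<Sum>k=1..n. nat \<bar>y k - x k\<bar>)"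
        by (rule sum_strict_mono_ex1)
          (use i in \<open>auto simp: shift_apply s_def D_def sgn_if intro!: bexI[of _ i]\<close>)
      show "?x' \<noteq> y"
      proof
        assume eq: "?x' = y"
        \<comment> \<open>Since \<open>y i = x i + s i\<close>, this puts \<open>f y i\<close>
          strictly on the side of \<open>x\<close>, against the condition at
          \<open>y\<close>.\<close>
        then have "s i * (f y i - x i) \<le> 0" using i by metis
        moreover have "s i * (f y i - y i) \<ge> 0" using i fy by (auto simp: D_def s_def)
        ultimately show False
          using i fun_cong[OF eq, of i] by (auto simp: D_def s_def shift_apply sgn_if split: if_splits)
      qed
      fix j assume j: "j \<in> {1..n}"
      show "sgn (y j - ?x' j) * (f ?x' j - ?x' j) \<le> 0"
        using s'[of j]
      proof
        assume A: "sgn (y j - ?x' j) = s j \<and> x j \<noteq> y j"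
        then have "s j * (f ?x' j - x j) \<le> 0" using j i(2)[of j] by (auto simp: D_def)
        \<comment> \<open>The two sides differ only for \<open>j = i\<close>, where the left one is
          smaller by 1.\<close>
        moreover have "s j * (f ?x' j - ?x' j) \<le> s j * (f ?x' j - x j)"
          by (auto simp: shift_apply s_def sgn_if)
        ultimately show ?thesis using A by simp
      qed simp
      show "sgn (y j - ?x' j) * (f y j - y j) \<ge> 0"
        using s'[of j] fy[OF j] by (auto simp: s_def)
    qed
  qed
qed

section \<open>From two attractors to a closest pair\<close>

text \<open>A nonempty intersection of trap sets is a trap set, so minimality makes it equal to both
  attractors.\<close>

lemma attractors_disjoint:
  assumes "attractor G A" "attractor G B" "A \<noteq> B"
  shows "A \<inter> B = {}"
proof (rule ccontr)
  assume "A \<inter> B \<noteq> {}"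
  then have "trap_set G (A \<inter> B)"
    using assms by (auto simp: attractor_def trap_set_def)
  then have "A \<inter> B = A" "A \<inter> B = B"
    using assms(1,2) by (auto simp only: attractor_def)
  with \<open>A \<noteq> B\<close> show False by simp
qed

lemma trap_set_async_dynamics_shift:
  assumes T: "trap_set (async_dynamics n m f) T" and "x \<in> T" "i \<in> {1..n}"
    and "s = sgn (f x i - x i)" "s \<noteq> 0"
  shows "shift x s i \<in> T"
proof -
  have "(x, shift x s i) \<in> arcs (async_dynamics n m f)"
    using assms by (auto simp: async_dynamics_def trap_set_def)
  then show ?thesis
    using T \<open>x \<in> T\<close> by (fastforce simp: trap_set_def async_dynamics_def)
qed

theorem theorem8:
  fixes n :: nat and m :: "nat \<Rightarrow> nat" and f :: "(nat \<Rightarrow> int) \<Rightarrow> (nat \<Rightarrow> int)"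
  assumes "\<forall>i\<in>{1..n}. m i \<ge> 1"
    and "f \<in> state_space n m \<rightarrow> state_space n m"
    and "\<exists>A B. attractor (async_dynamics n m f) A \<and> attractor (async_dynamics n m f) B \<and> A \<noteq> B"
  shows "\<exists>x\<in>admissible n m. \<exists>p. positive_cycle
    (local_interaction_graph (bool_index n m) (admissible n m) (bool_map n m f) x) p"
proof -
  from assms(3) obtain A B where A: "trap_set (async_dynamics n m f) A"
    and B: "trap_set (async_dynamics n m f) B" and "A \<inter> B = {}"
    by (meson attractor_def attractors_disjoint)
  define d :: "(nat \<Rightarrow> int) \<times> (nat \<Rightarrow> int) \<Rightarrow> nat"
    where "d = (\<lambda>(x, y). \<Sum>i=1..n. nat \<bar>y i - x i\<bar>)"
  from A B have "\<exists>q. q \<in> A \<times> B" by (auto simp: trap_set_def)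
  then obtain q where q: "q \<in> A \<times> B" and "\<And>q'. q' \<in> A \<times> B \<Longrightarrow> d q \<le> d q'"
    using exists_least_iff[of "\<lambda>k. \<exists>q\<in>A \<times> B. d q = k"] by (metis not_less)
  then obtain x y where x: "x \<in> A" and y: "y \<in> B"
    and le: "\<And>x' y'. x' \<in> A \<Longrightarrow> y' \<in> B \<Longrightarrow> d (x, y) \<le> d (x', y')"
    by (cases q) auto
  show ?thesis
  proof (rule positive_cycle_if_blocked)
    show "x \<in> state_space n m" "y \<in> state_space n m"
      using x y A B by (auto simp: trap_set_def async_dynamics_def)
    show "x \<noteq> y" using x y \<open>A \<inter> B = {}\<close> by auto
    fix i assume i: "i \<in> {1..n}"
    show "sgn (y i - x i) * (f x i - x i) \<le> 0"
    proof (rule ccontr)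
      assume *: "\<not> ?thesis"
      then have s: "sgn (y i - x i) = sgn (f x i - x i)" "sgn (y i - x i) \<noteq> 0"
        by (auto simp: sgn_if split: if_splits)
      \<comment> \<open>An edge from \<open>x\<close> towards \<open>y\<close> would stay in
        \<open>A\<close> and end one unit closer to \<open>y\<close>, against minimality. At
        \<open>y\<close> the argument is the same with the direction reversed.\<close>
      have "shift x (sgn (y i - x i)) i \<in> A"
        by (rule trap_set_async_dynamics_shift[OF A x i s])
      from le[OF this y] have "d (x, y) \<le> d (shift x (sgn (y i - x i)) i, y)" .
      moreover have "d (shift x (sgn (y i - x i)) i, y) < d (x, y)"
        unfolding d_def prod.case
        by (rule sum_strict_mono_ex1)
          (use i s(2) in \<open>auto simp: shift_apply sgn_if intro!: bexI[of _ i]\<close>)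
      ultimately show False by simp
    qed
    show "sgn (y i - x i) * (f y i - y i) \<ge> 0"
    proof (rule ccontr)
      assume *: "\<not> ?thesis"
      then have s: "sgn (x i - y i) = sgn (f y i - y i)" "sgn (x i - y i) \<noteq> 0"
        by (auto simp: sgn_if split: if_splits)
      have "shift y (sgn (x i - y i)) i \<in> B"
        by (rule trap_set_async_dynamics_shift[OF B y i s])
      from le[OF x this] have "d (x, y) \<le> d (x, shift y (sgn (x i - y i)) i)" .
      moreover have "d (x, shift y (sgn (x i - y i)) i) < d (x, y)"
        unfolding d_def prod.case
        by (rule sum_strict_mono_ex1)
          (use i s(2) in \<open>auto simp: shift_apply sgn_if intro!: bexI[of _ i]\<close>)
      ultimately show False by simp
    qed
  qed
qed

end
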